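(* For every integer $m$ with $1\le m<\omega$, $I_m\in{\cal I}(\aleph_{m+1})$; that is, every coloring $f:[\aleph_{m+1}]^2\to\omega$ realizes $I_m$.
   Context: A (finite) identity is a structure $\langle A,E\rangle$, $A$ a finite set, $E$ an equivalence relation on $[A]^2$. A coloring $f:[B]^2\to\omega$ ($B$ a set of ordinals) realizes $\langle A,E\rangle$ if there is a one-to-one $k:A\to B$ such that $\{x,y\}E\{u,v\}$ implies $f(\{k(x),k(y)\})=f(\{k(u),k(v)\})$. ${\cal I}(\kappa)$ is the collection of finite identities realized by every $f:[\kappa]^2\to\omega$. $I_m$ is the identity $\langle A,E\rangle$ with $A={}^{m+1}2$ (binary sequences of length $m+1$) and $\{\eta,\nu\}E\{\alpha,\beta\}$ iff $\eta\cap\nu=\alpha\cap\beta$, where $\eta\cap\nu$ is the longest common initial segment of $\eta$ and $\nu$. *)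

theory Defs
  imports Main "HOL-Library.Ramsey" "HOL-Library.Sublist"
begin

unbundle cardinal_syntax

text \<open>
  HOL does not guarantee one type with cardinals \<open>\<aleph>\<^sub>n\<close> for all \<open>n\<close>, so \<open>\<aleph>\<^sub>n\<close> is a predicate on
  relations rather than a function of \<open>n\<close>: \<open>is_aleph n r\<close> means that \<open>r\<close> is a cardinal
  (a well-order of minimal type on its field) of cardinality \<open>\<aleph>\<^sub>n\<close>.
  Restricting the predecessor \<open>s\<close> to the type of \<open>r\<close> loses nothing, since \<open>s\<close> embeds into \<open>r\<close>.
  The predicate fixes \<open>r\<close> up to isomorphism (\<open>is_aleph_unique\<close>), and every \<open>\<aleph>\<^sub>n\<close> exists at some type
  (\<open>is_aleph_natLeq\<close>, \<open>is_aleph_cardSuc\<close>).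
\<close>

primrec is_aleph :: "nat \<Rightarrow> 'a rel \<Rightarrow> bool" where
  "is_aleph 0 r \<longleftrightarrow> r =o natLeq"
| "is_aleph (Suc n) r \<longleftrightarrow> (\<exists>s :: 'a rel. is_aleph n s \<and> r =o cardSuc s)"

lemma is_aleph_Card_order: "is_aleph n r \<Longrightarrow> Card_order r"
  by (induction n arbitrary: r)
    (auto intro: Card_order_ordIso natLeq_Card_order cardSuc_Card_order)

lemma Card_order_ordLeq_copy:
  fixes s :: "'a rel" and r :: "'b rel"
  assumes "Card_order s" "s \<le>o r"
  obtains s' :: "'b rel" where "s' =o s"
proof -
  have "Card_order |Field s|" "|Field s| =o s"
    using assms(1) by (auto intro: card_of_Card_order card_of_Field_ordIso)
  moreover have "|Field s| \<le>o |Field r|"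
    using assms(2) by (rule card_of_mono2)
  then obtain f :: "'a \<Rightarrow> 'b" where "inj_on f (Field s)"
    by (auto simp: card_of_ordLeq[symmetric])
  then have "|f ` Field s| =o |Field s|"
    by (meson card_of_ordIsoI inj_on_imp_bij_betw ordIso_symmetric)
  ultimately show ?thesis
    using that ordIso_transitive by blast
qed

lemma is_aleph_ordIso:
  "is_aleph n (r :: 'a rel) \<Longrightarrow> (r' :: 'b rel) =o r \<Longrightarrow> is_aleph n r'"
proof (induction n arbitrary: r r')
  case 0
  then show ?case by (auto intro: ordIso_transitive)
next
  case (Suc n)
  then obtain s :: "'a rel" where s: "is_aleph n s" "r =o cardSuc s" by auto
  have co: "Card_order s" using s(1) by (rule is_aleph_Card_order)
  have r': "r' =o cardSuc s" using Suc.prems(2) s(2) by (rule ordIso_transitive)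
  have "s \<le>o r'"
    using cardSuc_greater[OF co] r'
    by (meson ordIso_symmetric ordLess_imp_ordLeq ordLeq_ordIso_trans)
  then obtain s' :: "'b rel" where s': "s' =o s" using co Card_order_ordLeq_copy by blast
  have "Card_order s'" using co s' by (rule Card_order_ordIso)
  then have "cardSuc s' =o cardSuc s" using co s' by (simp add: cardSuc_invar_ordIso)
  then have "r' =o cardSuc s'" using r' by (meson ordIso_symmetric ordIso_transitive)
  then show ?case using Suc.IH[OF s(1) s'] by auto
qed

lemma is_aleph_unique: "is_aleph n (r :: 'a rel) \<Longrightarrow> is_aleph n (r' :: 'b rel) \<Longrightarrow> r =o r'"
proof (induction n arbitrary: r r')
  case 0
  then show ?case by simp (meson ordIso_symmetric ordIso_transitive)
next
  case (Suc n)
  then obtain s :: "'a rel" and s' :: "'b rel" where "is_aleph n s" "r =o cardSuc s" "is_aleph n s'" "r' =o cardSuc s'"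
    by auto
  moreover from this have "cardSuc s =o cardSuc s'"
    using Suc.IH by (simp add: cardSuc_invar_ordIso is_aleph_Card_order)
  ultimately show ?case by (meson ordIso_symmetric ordIso_transitive)
qed

lemma is_aleph_natLeq: "is_aleph 0 natLeq"
  by (simp add: natLeq_Card_order ordIso_refl)

lemma is_aleph_cardSuc:
  assumes "is_aleph n (r :: 'a rel)"
  shows "is_aleph (Suc n) (cardSuc r)"
proof -
  have co: "Card_order r" using assms by (rule is_aleph_Card_order)
  obtain s :: "'a set rel" where "s =o r"
    using Card_order_ordLeq_copy[OF co ordLess_imp_ordLeq[OF cardSuc_greater[OF co]]] .
  moreover from this have "Card_order s" using co Card_order_ordIso by blast
  ultimately have "is_aleph n s" "cardSuc r =o cardSuc s"
    using co is_aleph_ordIso[OF assms, of s] cardSuc_invar_ordIso[of s r] ordIso_symmetric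
    by blast+
  then show ?thesis by auto
qed

text \<open>A structure \<open>\<langle>A, E\<rangle>\<close> is a pair; \<open>[A]\<^bsup>2\<^esup>\<close> is the set of two-element subsets of \<open>A\<close>.\<close>

type_synonym 'b identity = "'b set \<times> 'b set rel"

definition finite_identity :: "'b identity \<Rightarrow> bool" where
  "finite_identity = (\<lambda>(A, E). finite A \<and> equiv ([A]\<^bsup>2\<^esup>) E)"

text \<open>
  A coloring of \<open>[B]\<^bsup>2\<^esup>\<close> is a function on all sets, of which only the values on \<open>[B]\<^bsup>2\<^esup>\<close> matter:
  for an identity \<open>\<langle>A, E\<rangle>\<close>, \<open>{x, y}\<close> and \<open>{u, v}\<close> below lie in \<open>[A]\<^bsup>2\<^esup>\<close> because \<open>E\<close> relates only such sets.
\<close>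

definition realizes :: "'a set \<Rightarrow> ('a set \<Rightarrow> nat) \<Rightarrow> 'b identity \<Rightarrow> bool" where
  "realizes B f = (\<lambda>(A, E). \<exists>k. inj_on k A \<and> k ` A \<subseteq> B \<and>
     (\<forall>x y u v. ({x, y}, {u, v}) \<in> E \<longrightarrow> f {k x, k y} = f {k u, k v}))"

definition realized_identities :: "'a rel \<Rightarrow> 'b identity set" where
  "realized_identities \<kappa> =
     {I. finite_identity I \<and> (\<forall>f :: 'a set \<Rightarrow> nat. realizes (Field \<kappa>) f I)}"

definition I_seq :: "nat \<Rightarrow> bool list identity" where
  "I_seq m = (let A = {\<eta>. length \<eta> = m + 1} in
     (A, {({\<eta>, \<nu>}, {\<alpha>, \<beta>}) | \<eta> \<nu> \<alpha> \<beta>.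
            {\<eta>, \<nu>} \<in> [A]\<^bsup>2\<^esup> \<and> {\<alpha>, \<beta>} \<in> [A]\<^bsup>2\<^esup> \<and>
            longest_common_prefix \<eta> \<nu> = longest_common_prefix \<alpha> \<beta>}))"

end

theory Submission
  imports Defs
begin

text \<open>
  Induction on \<open>m\<close>: every set of more than \<open>\<aleph>\<^sub>m\<close> points contains a copy of \<open>I\<^sub>m\<close>. In a set of more
  than \<open>\<aleph>\<^bsub>m+1\<^esub>\<close> points fix a subset \<open>C\<close> of size \<open>\<aleph>\<^bsub>m+1\<^esub>\<close>. Every point \<open>\<beta>\<close> outside \<open>C\<close> sends edges of a
  single color to more than \<open>\<aleph>\<^sub>m\<close> points of \<open>C\<close>, hence to a copy of \<open>I\<^sub>m\<close> in \<open>C\<close>. There are only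
  \<open>\<aleph>\<^bsub>m+1\<^esub>\<close> pairs of a color and a copy, so some pair is shared by more than \<open>\<aleph>\<^bsub>m+1\<^esub>\<close> points \<open>\<beta>\<close>, among
  which lies a second copy of \<open>I\<^sub>m\<close>. The two copies together form a copy of \<open>I\<^bsub>m+1\<^esub>\<close>.
\<close>

section \<open>Pigeonhole principles for infinite cardinals\<close>

lemma card_of_ordLeq_if_not_ordLess:
  assumes "Card_order t" "\<not> t <o |A|"
  shows "|A| \<le>o t"
  using assms not_ordLess_iff_ordLeq[of "|A|" t] card_order_on_well_order_on card_of_Well_order
  by blast

text \<open>Otherwise every fiber has size at most \<open>t\<close>, and so has \<open>D\<close>,
  being a union of at most \<open>t\<close> fibers with \<open>t\<close> infinite.\<close>

lemma large_fiber:
  assumes "Card_order t" "infinite (Field t)" "t <o |D|" "|g ` D| \<le>o t"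
  obtains v where "t <o |{d \<in> D. g d = v}|"
proof (rule ccontr)
  assume "\<not> thesis"
  then have "\<not> t <o |{d \<in> D. g d = v}|" for v
    using that by blast
  then have "|{d \<in> D. g d = v}| \<le>o t" for v
    using card_of_ordLeq_if_not_ordLess[OF assms(1)] by blast
  then have "|\<Union>v \<in> g ` D. {d \<in> D. g d = v}| \<le>o t"
    using assms by (intro card_of_UNION_ordLeq_infinite_Field) auto
  moreover have "(\<Union>v \<in> g ` D. {d \<in> D. g d = v}) = D"
    by auto
  ultimately show False
    using assms(3) not_ordLess_ordLeq by auto
qed

text \<open>Iterating the pigeonhole over the finitely many coordinates in \<open>X\<close> makes
  whole tuples agree, without counting the functions from \<open>X\<close> to
  \<open>C\<close>.\<close>

lemma large_fiber_finite:
  assumes "Card_order t" "infinite (Field t)" "t <o |D|" "|C| \<le>o t"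
    and "finite X" "\<And>d x. d \<in> D \<Longrightarrow> x \<in> X \<Longrightarrow> g d x \<in> C"
  shows "\<exists>v. t <o |{d \<in> D. \<forall>x \<in> X. g d x = v x}|"
  using assms(5,6)
proof (induction rule: finite_induct)
  case empty
  then show ?case using assms(3) by simp
next
  case (insert x X)
  then obtain v where v: "t <o |{d \<in> D. \<forall>x \<in> X. g d x = v x}|" (is "_ <o |?D'|")
    by auto
  have "(\<lambda>d. g d x) ` ?D' \<subseteq> C"
    using insert.prems by auto
  then have "|(\<lambda>d. g d x) ` ?D'| \<le>o t"
    using assms(4) card_of_mono1 ordLeq_transitive by blast
  then obtain a where "t <o |{d \<in> ?D'. g d x = a}|"
    using large_fiber[OF assms(1,2) v] by blast
  \<comment> \<open>As \<open>x\<close> is not in \<open>X\<close>, the update at \<open>x\<close>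
    keeps the values already fixed on \<open>X\<close>.\<close>
  moreover have "{d \<in> ?D'. g d x = a} = {d \<in> D. \<forall>y \<in> insert x X. g d y = (v(x := a)) y}"
    using insert.hyps by auto
  ultimately show ?case
    by metis
qed

section \<open>Alephs are infinite and absorb small sets\<close>

lemma infinite_Field_iff_natLeq_ordLeq:
  assumes "Card_order t"
  shows "infinite (Field t) \<longleftrightarrow> natLeq \<le>o t"
  using assms infinite_iff_natLeq_ordLeq[of "Field t"] card_of_Field_ordIso[of t]
    ordLeq_ordIso_trans ordIso_symmetric by blast

lemma is_aleph_natLeq_ordLeq: "is_aleph n (t :: 'a rel) \<Longrightarrow> natLeq \<le>o t"
proof (induction n arbitrary: t)
  case 0
  then show ?case by (simp add: ordIso_iff_ordLeq)
next
  case (Suc n)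
  then obtain s :: "'a rel" where s: "is_aleph n s" "t =o cardSuc s" by auto
  then have "natLeq \<le>o cardSuc s"
    using Suc.IH cardSuc_ordLeq is_aleph_Card_order ordLeq_transitive by blast
  then show ?case
    using s(2) ordIso_symmetric ordLeq_ordIso_trans by blast
qed

lemma is_aleph_infinite_Field: "is_aleph n t \<Longrightarrow> infinite (Field t)"
  using infinite_Field_iff_natLeq_ordLeq is_aleph_natLeq_ordLeq is_aleph_Card_order by blast

lemma is_aleph_card_of_nat_ordLeq:
  assumes "is_aleph n t"
  shows "|A :: nat set| \<le>o t"
proof -
  have "|A| \<le>o |UNIV :: nat set|"
    by (simp add: card_of_mono1)
  then show ?thesis
    using is_aleph_natLeq_ordLeq[OF assms] card_of_nat ordLeq_ordIso_trans ordLeq_transitive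
    by blast
qed

lemma ordLess_card_of_Diff:
  assumes "Card_order t" "infinite (Field t)" "t <o |B|" "|C| \<le>o t"
  shows "t <o |B - C|"
proof (rule ccontr)
  assume "\<not> t <o |B - C|"
  then have "|B - C| \<le>o t"
    using card_of_ordLeq_if_not_ordLess[OF assms(1)] by blast
  then have "|(B - C) \<union> C| \<le>o t"
    using assms by (intro card_of_Un_ordLeq_infinite_Field)
  moreover have "|B| \<le>o |(B - C) \<union> C|"
    by (intro card_of_mono1) auto
  ultimately show False
    using assms(3) not_ordLess_ordLeq ordLeq_transitive by blast
qed

section \<open>Copies of the identities inside a coloring\<close>

text \<open>This is realization in terms of pairs of distinct sequences, so that the induction
  avoids sets of edges; \<open>I_seq m\<close> corresponds to \<open>n = m + 1\<close>.\<close>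

definition meet_copy :: "nat \<Rightarrow> 'a set \<Rightarrow> ('a set \<Rightarrow> nat) \<Rightarrow> (bool list \<Rightarrow> 'a) \<Rightarrow> bool" where
  "meet_copy n B f k \<longleftrightarrow> inj_on k {\<eta>. length \<eta> = n} \<and> k ` {\<eta>. length \<eta> = n} \<subseteq> B \<and>
     (\<forall>\<eta> \<nu> \<alpha> \<beta>. length \<eta> = n \<longrightarrow> length \<nu> = n \<longrightarrow> length \<alpha> = n \<longrightarrow> length \<beta> = n \<longrightarrow>
        \<eta> \<noteq> \<nu> \<longrightarrow> \<alpha> \<noteq> \<beta> \<longrightarrow> longest_common_prefix \<eta> \<nu> = longest_common_prefix \<alpha> \<beta> \<longrightarrow>
        f {k \<eta>, k \<nu>} = f {k \<alpha>, k \<beta>})"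

lemma meet_copy_mono: "meet_copy n B f k \<Longrightarrow> B \<subseteq> B' \<Longrightarrow> meet_copy n B' f k"
  unfolding meet_copy_def by blast

lemma meet_copy_mem: "meet_copy n B f k \<Longrightarrow> length \<eta> = n \<Longrightarrow> k \<eta> \<in> B"
  unfolding meet_copy_def by blast

lemma meet_copy_eq:
  "meet_copy n B f k \<Longrightarrow> length \<eta> = n \<Longrightarrow> length \<nu> = n \<Longrightarrow> length \<alpha> = n \<Longrightarrow> length \<beta> = n \<Longrightarrow>
     \<eta> \<noteq> \<nu> \<Longrightarrow> \<alpha> \<noteq> \<beta> \<Longrightarrow> longest_common_prefix \<eta> \<nu> = longest_common_prefix \<alpha> \<beta> \<Longrightarrow>
     f {k \<eta>, k \<nu>} = f {k \<alpha>, k \<beta>}"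
  unfolding meet_copy_def by blast

text \<open>The two sequences of length 1 span a single edge, so any two distinct points will
  do.\<close>

lemma meet_copy_1:
  assumes "infinite B"
  shows "\<exists>k. meet_copy 1 B f k"
proof -
  obtain a where a: "a \<in> B"
    using assms by fastforce
  obtain b where b: "b \<in> B" "b \<noteq> a"
    using assms by (metis finite.emptyI finite_insert finite_subset insertI1 subsetI)
  have "meet_copy 1 B f (\<lambda>\<eta>. if hd \<eta> then a else b)"
    unfolding meet_copy_def using a b by (auto simp: inj_on_def length_Suc_conv insert_commute)
  then show ?thesis by blast
qed

text \<open>The first bit selects one of the two copies. Edges with nonempty meet stay inside one
  copy; edges with empty meet cross between the copies and all have color \<open>c\<close>.\<close>

lemma meet_copy_Suc:
  assumes "meet_copy n C f k" "meet_copy n D f l" "C \<inter> D = {}"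
    and c: "\<And>\<eta> \<nu>. length \<eta> = n \<Longrightarrow> length \<nu> = n \<Longrightarrow> f {k \<eta>, l \<nu>} = c"
  shows "meet_copy (Suc n) (C \<union> D) f (\<lambda>\<eta>. if hd \<eta> then k (tl \<eta>) else l (tl \<eta>))"
    (is "meet_copy _ _ _ ?h")
proof -
  have inj: "k \<eta> = k \<nu> \<Longrightarrow> \<eta> = \<nu>" "l \<eta> = l \<nu> \<Longrightarrow> \<eta> = \<nu>"
    if "length \<eta> = n" "length \<nu> = n" for \<eta> \<nu>
    using assms(1,2) that by (auto simp: meet_copy_def dest: inj_onD)
  have disj: "k \<eta> \<noteq> l \<nu>" "l \<nu> \<noteq> k \<eta>"
    if "length \<eta> = n" "length \<nu> = n" for \<eta> \<nu>
    using assms(3) meet_copy_mem[OF assms(1) that(1)] meet_copy_mem[OF assms(2) that(2)] by auto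
  have "inj_on ?h {\<eta>. length \<eta> = Suc n}"
    using inj disj by (auto simp: inj_on_def length_Suc_conv)
  moreover have "?h ` {\<eta>. length \<eta> = Suc n} \<subseteq> C \<union> D"
    using meet_copy_mem[OF assms(1)] meet_copy_mem[OF assms(2)] by (auto simp: length_Suc_conv)
  moreover have "f {?h \<eta>, ?h \<nu>} = f {?h \<alpha>, ?h \<beta>}"
    if H: "length \<eta> = Suc n" "length \<nu> = Suc n" "length \<alpha> = Suc n" "length \<beta> = Suc n"
      "\<eta> \<noteq> \<nu>" "\<alpha> \<noteq> \<beta>" "longest_common_prefix \<eta> \<nu> = longest_common_prefix \<alpha> \<beta>"
    for \<eta> \<nu> \<alpha> \<beta>
  proof -
    obtain x1 e x2 v x3 a x4 b where
      eqs: "\<eta> = x1 # e" "\<nu> = x2 # v" "\<alpha> = x3 # a" "\<beta> = x4 # b"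
      and len: "length e = n" "length v = n" "length a = n" "length b = n"
      using H(1-4) by (auto simp: length_Suc_conv)
    have c': "\<And>\<eta> \<nu>. length \<eta> = n \<Longrightarrow> length \<nu> = n \<Longrightarrow> f {l \<eta>, k \<nu>} = c"
      using c by (simp add: insert_commute)
    show ?thesis
    proof (cases "x1 = x2")
      case True
      \<comment> \<open>The common meet starts with \<open>x1\<close>, so all four sequences do:
        both edges lie in the same copy.\<close>
      then have "x2 = x1" "x3 = x1" "x4 = x1" "e \<noteq> v" "a \<noteq> b"
        "longest_common_prefix e v = longest_common_prefix a b"
        using H(5-7) eqs by (auto split: if_splits)
      then show ?thesis
        using meet_copy_eq[OF assms(1) len] meet_copy_eq[OF assms(2) len] by (simp add: eqs)
    next
      case False
      then have "x3 \<noteq> x4"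
        using H(7) eqs by (auto split: if_splits)
      with False show ?thesis
        using len c c' by (auto simp: eqs)
    qed
  qed
  ultimately show ?thesis
    unfolding meet_copy_def by blast
qed

section \<open>The induction on the cardinal\<close>

text \<open>The set \<open>B\<close> varies because the induction hypothesis is used twice: on color
  fibers inside \<open>C\<close>, and on a set of points outside \<open>C\<close>.\<close>

lemma ex_meet_copy:
  fixes f :: "'a set \<Rightarrow> nat"
  shows "is_aleph n (t :: 'a rel) \<Longrightarrow> t <o |B| \<Longrightarrow> \<exists>k. meet_copy (Suc n) B f k"
proof (induction n arbitrary: t B)
  case 0
  then have "natLeq \<le>o |B|"
    by (meson is_aleph_natLeq_ordLeq ordLess_imp_ordLeq ordLeq_transitive)
  then have "infinite B"
    using infinite_iff_natLeq_ordLeq[of B] by blast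
  then show ?case
    using meet_copy_1 by simp
next
  case (Suc n)
  from Suc.prems(1) obtain s :: "'a rel" where s: "is_aleph n s" "t =o cardSuc s"
    by auto
  note co_s = is_aleph_Card_order[OF s(1)] and inf_s = is_aleph_infinite_Field[OF s(1)]
  note co_t = is_aleph_Card_order[OF Suc.prems(1)]
    and inf_t = is_aleph_infinite_Field[OF Suc.prems(1)]
  have st: "s <o t"
    using cardSuc_greater[OF co_s] s(2) ordIso_symmetric ordLess_ordIso_trans by blast
  have Ft: "|Field t| =o t"
    using co_t by (rule card_of_Field_ordIso)
  then have "|Field t| \<le>o |B|"
    using Suc.prems(2) ordIso_ordLeq_trans ordLess_imp_ordLeq by blast
  then obtain C where C: "C \<subseteq> B" "|Field t| =o |C|"
    unfolding internalize_card_of_ordLeq2[of "Field t" B] by blast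
  have Ct: "|C| =o t"
    using C(2) Ft ordIso_symmetric ordIso_transitive by blast
  have C_le: "|C| \<le>o t"
    using Ct by (rule ordIso_imp_ordLeq)
  have sC: "s <o |C|"
    using st ordIso_symmetric[OF Ct] by (rule ordLess_ordIso_trans)
  \<comment> \<open>There are at most \<open>s\<close> colors and more than \<open>s\<close> points
    in \<open>C\<close>. Letting \<open>d\<close> range over the whole type makes the chosen
    \<open>c\<close> and \<open>k\<close> total; only points outside \<open>C\<close> matter
    later.\<close>
  have "\<exists>c k. meet_copy (Suc n) {a \<in> C. f {a, d} = c} f k" for d
  proof -
    obtain c where "s <o |{a \<in> C. f {a, d} = c}|"
      using large_fiber[where g = "\<lambda>a. f {a, d}",
          OF co_s inf_s sC is_aleph_card_of_nat_ordLeq[OF s(1)]] .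
    then have "\<exists>k. meet_copy (Suc n) {a \<in> C. f {a, d} = c} f k"
      by (rule Suc.IH[OF s(1)])
    then show ?thesis ..
  qed
  then obtain c k where ck: "meet_copy (Suc n) {a \<in> C. f {a, d} = c d} f (k d)" for d
    by metis
  have kC: "k d \<eta> \<in> C" "f {k d \<eta>, d} = c d" if "length \<eta> = Suc n" for d \<eta>
    using meet_copy_mem[OF ck that] by auto
  have BC: "t <o |B - C|"
    using ordLess_card_of_Diff[OF co_t inf_t Suc.prems(2) C_le] .
  \<comment> \<open>The pair of color and copy is made constant in two stages: first the color, then
    the finitely many vertices, each of which has at most \<open>t\<close> possible values in
    \<open>C\<close>.\<close>
  obtain c0 where c0: "t <o |{d \<in> B - C. c d = c0}|" (is "_ <o |?D|")
    using large_fiber[where g = c,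
        OF co_t inf_t BC is_aleph_card_of_nat_ordLeq[OF Suc.prems(1)]] .
  have fin: "finite {\<eta> :: bool list. length \<eta> = Suc n}"
    using finite_lists_length_eq[of "UNIV :: bool set" "Suc n"] by simp
  obtain v where
    v: "t <o |{d \<in> ?D. \<forall>\<eta> \<in> {\<eta>. length \<eta> = Suc n}. k d \<eta> = v \<eta>}|" (is "_ <o |?E|")
    using large_fiber_finite[OF co_t inf_t c0 C_le fin, of k] kC(1) by auto
  have "s <o |?E|"
    using st v by (rule ordLess_transitive)
  then have "\<exists>l. meet_copy (Suc n) ?E f l"
    by (rule Suc.IH[OF s(1)])
  then obtain l where l: "meet_copy (Suc n) ?E f l" ..
  \<comment> \<open>A point \<open>d0\<close> of \<open>?E\<close> is needed to turn the common
    values \<open>v\<close> into an actual copy, \<open>k d0\<close>.\<close>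
  have "?E \<noteq> {}"
  proof
    assume "?E = {}"
    with v have "t <o |{} :: 'a set|" by (rule subst[rotated])
    then show False
      using card_of_empty1 co_t not_ordLess_ordLeq by blast
  qed
  then obtain d0 where "d0 \<in> ?E"
    by blast
  then have k_d0: "k d \<eta> = k d0 \<eta>" if "d \<in> ?E" "length \<eta> = Suc n" for d \<eta>
    using that by simp
  have "meet_copy (Suc n) C f (k d0)"
    using ck by (rule meet_copy_mono) auto
  moreover have "C \<inter> ?E = {}"
    by auto
  moreover have "f {k d0 \<eta>, l \<nu>} = c0" if "length \<eta> = Suc n" "length \<nu> = Suc n" for \<eta> \<nu>
  proof -
    \<comment> \<open>The vertex \<open>k d0 \<eta>\<close> is also
      \<open>k (l \<nu>) \<eta>\<close>, which is joined to \<open>l \<nu>\<close> by color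
      \<open>c (l \<nu>) = c0\<close>.\<close>
    have "l \<nu> \<in> ?E"
      using meet_copy_mem[OF l that(2)] .
    then show ?thesis
      using k_d0[of "l \<nu>" \<eta>] kC(2)[of \<eta> "l \<nu>"] that by auto
  qed
  ultimately obtain h where "meet_copy (Suc (Suc n)) (C \<union> ?E) f h"
    using meet_copy_Suc[OF _ l] by blast
  then have "meet_copy (Suc (Suc n)) B f h"
    by (rule meet_copy_mono) (use C(1) in auto)
  then show ?case by blast
qed

section \<open>From copies to realized identities\<close>

lemma longest_common_prefix_commute:
  "longest_common_prefix xs ys = longest_common_prefix ys xs"
  by (induction xs ys rule: longest_common_prefix.induct) auto

lemma longest_common_prefix_doubleton:
  "{\<eta>, \<nu>} = {\<alpha>, \<beta>} \<Longrightarrow> longest_common_prefix \<eta> \<nu> = longest_common_prefix \<alpha> \<beta>"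
  using longest_common_prefix_commute by (auto simp only: doubleton_eq_iff)

text \<open>Membership in \<open>E\<close> only provides some enumeration of each edge; since meets
  are symmetric, the given enumeration has the same meet.\<close>

lemma I_seq_iff:
  assumes "I_seq m = (A, E)"
  shows "({\<eta>, \<nu>}, {\<alpha>, \<beta>}) \<in> E \<longleftrightarrow> {\<eta>, \<nu>} \<in> [A]\<^bsup>2\<^esup> \<and> {\<alpha>, \<beta>} \<in> [A]\<^bsup>2\<^esup> \<and>
     longest_common_prefix \<eta> \<nu> = longest_common_prefix \<alpha> \<beta>"
    (is "?l \<longleftrightarrow> ?r")
proof -
  have E: "E = {({\<eta>, \<nu>}, {\<alpha>, \<beta>}) | \<eta> \<nu> \<alpha> \<beta>. {\<eta>, \<nu>} \<in> [A]\<^bsup>2\<^esup> \<and> {\<alpha>, \<beta>} \<in> [A]\<^bsup>2\<^esup> \<and>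
      longest_common_prefix \<eta> \<nu> = longest_common_prefix \<alpha> \<beta>}"
    using assms unfolding I_seq_def Let_def by (elim Pair_inject) simp
  show ?thesis
  proof
    assume ?l
    then obtain \<eta>' \<nu>' \<alpha>' \<beta>' where eqs: "{\<eta>, \<nu>} = {\<eta>', \<nu>'}" "{\<alpha>, \<beta>} = {\<alpha>', \<beta>'}"
      and E': "{\<eta>', \<nu>'} \<in> [A]\<^bsup>2\<^esup>" "{\<alpha>', \<beta>'} \<in> [A]\<^bsup>2\<^esup>"
        "longest_common_prefix \<eta>' \<nu>' = longest_common_prefix \<alpha>' \<beta>'"
      unfolding E by blast
    show ?r
      using E' unfolding longest_common_prefix_doubleton[OF eqs(1)]
        longest_common_prefix_doubleton[OF eqs(2)] eqs by blast
  next
    assume ?r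
    then show ?l
      unfolding E by blast
  qed
qed

lemma finite_identity_I_seq: "finite_identity (I_seq m)"
proof -
  obtain A E where AE: "I_seq m = (A, E)"
    by (cases "I_seq m")
  then have A: "A = {\<eta>. length \<eta> = m + 1}"
    by (simp add: I_seq_def Let_def)
  have sub: "E \<subseteq> [A]\<^bsup>2\<^esup> \<times> [A]\<^bsup>2\<^esup>"
    using AE by (auto simp: I_seq_def Let_def)
  note iff = I_seq_iff[OF AE]
  have "refl_on ([A]\<^bsup>2\<^esup>) E"
  proof (rule refl_onI)
    fix e assume "e \<in> [A]\<^bsup>2\<^esup>"
    then show "(e, e) \<in> E"
      by (elim nsets2_E) (simp add: iff A)
  qed
  moreover have "sym E"
  proof (rule symI)
    fix p q assume pq: "(p, q) \<in> E"
    then have "p \<in> [A]\<^bsup>2\<^esup>" "q \<in> [A]\<^bsup>2\<^esup>"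
      using sub by auto
    with pq show "(q, p) \<in> E"
      by (elim nsets2_E) (auto simp: iff)
  qed
  moreover have "trans E"
  proof (rule transI)
    fix p q r assume pq: "(p, q) \<in> E" "(q, r) \<in> E"
    then have "p \<in> [A]\<^bsup>2\<^esup>" "q \<in> [A]\<^bsup>2\<^esup>" "r \<in> [A]\<^bsup>2\<^esup>"
      using sub by auto
    with pq show "(p, r) \<in> E"
      by (elim nsets2_E) (auto simp: iff)
  qed
  moreover have "finite A"
    using A finite_lists_length_eq[of "UNIV :: bool set" "m + 1"] by simp
  ultimately show ?thesis
    using sub by (simp add: finite_identity_def AE equiv_def)
qed

lemma realizes_I_seq:
  assumes "meet_copy (m + 1) B f k"
  shows "realizes B f (I_seq m)"
proof -
  obtain A E where AE: "I_seq m = (A, E)"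
    by (cases "I_seq m")
  then have A: "A = {\<eta>. length \<eta> = m + 1}"
    by (simp add: I_seq_def Let_def)
  have "f {k x, k y} = f {k u, k v}" if "({x, y}, {u, v}) \<in> E" for x y u v
    using that unfolding I_seq_iff[OF AE] doubleton_in_nsets_2 A
    by (intro meet_copy_eq[OF assms]) simp_all
  moreover have "inj_on k A" "k ` A \<subseteq> B"
    using assms unfolding meet_copy_def A by blast+
  ultimately show ?thesis
    unfolding realizes_def AE by blast
qed

theorem theorem6:
  fixes m :: nat and \<kappa> :: "'a rel"
  assumes "1 \<le> m" and "is_aleph (m + 1) \<kappa>"
  shows "I_seq m \<in> realized_identities \<kappa>"
proof -
  \<comment> \<open>The predecessor \<open>s\<close> of \<open>\<kappa>\<close> is the cardinal that
    \<open>Field \<kappa>\<close> has to exceed.\<close>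
  obtain s :: "'a rel" where s: "is_aleph m s" "\<kappa> =o cardSuc s"
    using assms(2) by auto
  have "s <o \<kappa>"
    using cardSuc_greater[OF is_aleph_Card_order[OF s(1)]] s(2)
      ordIso_symmetric ordLess_ordIso_trans by blast
  moreover have "\<kappa> =o |Field \<kappa>|"
    using is_aleph_Card_order[OF assms(2)] card_of_Field_ordIso ordIso_symmetric by blast
  ultimately have "s <o |Field \<kappa>|"
    by (rule ordLess_ordIso_trans)
  then have "realizes (Field \<kappa>) f (I_seq m)" for f
    using ex_meet_copy[OF s(1)] realizes_I_seq by (metis Suc_eq_plus1)
  then show ?thesis
    by (simp add: realized_identities_def finite_identity_I_seq)
qed

end
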